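(* Let $F$ be an infinite field with $\operatorname{char}(F)\ne 2$, let $V$ be an infinite-dimensional vector space over $F$, and let $f\in F\langle\mathcal X\rangle$ be a nonconstant polynomial. Then every element in $A=\operatorname{End}_F(V)$ is a sum of $1958$ elements from $f(A)-f(A)$.
   Context: $F\langle \mathcal X\rangle$ is the free (unital, associative) algebra over $F$ on $\mathcal X=\{X_1,X_2,\dots\}$, i.e. the algebra of noncommutative polynomials. For $f=f(X_1,\dots,X_m)$, $f(A)=\{f(a_1,\dots,a_m)\mid a_1,\dots,a_m\in A\}$ and $f(A)-f(A)=\{t-t'\mid t,t'\in f(A)\}$. $\operatorname{End}_F(V)$ is the algebra of all $F$-linear maps $V\to V$. *)

theory Defs
  imports Complex_Main "HOL-Library.Poly_Mapping"
begin

text \<open>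
  Words are the monomials of the free algebra: the free monoid on countably many letters
  indexed by \<^typ>\<open>nat\<close>, written additively because multiplication of
  \<^type>\<open>poly_mapping\<close> is convolution along \<^class>\<open>monoid_add\<close>. (A separate type avoids a
  global \<^class>\<open>monoid_add\<close> instance for lists.)
\<close>

datatype word = Word (letters: "nat list")

instantiation word :: monoid_add
begin

definition zero_word :: word where
  "0 = Word []"

definition plus_word :: "word \<Rightarrow> word \<Rightarrow> word" where
  "u + w = Word (letters u @ letters w)"

instance
  by standard (simp_all add: zero_word_def plus_word_def)

end

type_synonym 'a free_algebra = "word \<Rightarrow>\<^sub>0 'a"

definition Var :: "nat \<Rightarrow> 'a::zero_neq_one free_algebra" where
  "Var i = Poly_Mapping.single (Word [i]) 1"

definition constant_poly :: "'a::zero free_algebra \<Rightarrow> bool" where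
  "constant_poly f \<longleftrightarrow> (\<exists>c. f = Poly_Mapping.single 0 c)"


definition End :: "('a::field \<Rightarrow> 'v::ab_group_add \<Rightarrow> 'v) \<Rightarrow> ('v \<Rightarrow> 'v) set" where
  "End scale = {T. Vector_Spaces.linear scale scale T}"

fun eval_letters :: "(nat \<Rightarrow> 'v \<Rightarrow> 'v) \<Rightarrow> nat list \<Rightarrow> 'v \<Rightarrow> 'v" where
  "eval_letters a [] = id"
| "eval_letters a (i # is) = a i \<circ> eval_letters a is"

definition nc_eval ::
  "('a::field \<Rightarrow> 'v::ab_group_add \<Rightarrow> 'v) \<Rightarrow> (nat \<Rightarrow> 'v \<Rightarrow> 'v) \<Rightarrow> 'a free_algebra \<Rightarrow> 'v \<Rightarrow> 'v" where
  "nc_eval scale a f =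
     (\<lambda>v. \<Sum>w\<in>Poly_Mapping.keys f. scale (Poly_Mapping.lookup f w) (eval_letters a (letters w) v))"

text \<open>
  All indeterminates are assigned a value here; \<^term>\<open>f\<close> ignores those that do not occur in it,
  so this is the set of all \<open>f(a\<^sub>1, \<dots>, a\<^sub>m)\<close>.
\<close>

definition poly_image ::
  "('a::field \<Rightarrow> 'v::ab_group_add \<Rightarrow> 'v) \<Rightarrow> 'a free_algebra \<Rightarrow> ('v \<Rightarrow> 'v) set" where
  "poly_image scale f = {nc_eval scale a f | a. \<forall>i. a i \<in> End scale}"

definition differences :: "('v \<Rightarrow> 'v::ab_group_add) set \<Rightarrow> ('v \<Rightarrow> 'v) set" where
  "differences S = {(\<lambda>v. t v - t' v) | t t'. t \<in> S \<and> t' \<in> S}"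


text \<open>Evaluation is the homomorphism of unital algebras sending each variable to its value.\<close>

lemma nc_eval_superset:
  assumes "vector_space scale" "finite K" "Poly_Mapping.keys f \<subseteq> K"
  shows "nc_eval scale a f v =
    (\<Sum>w\<in>K. scale (Poly_Mapping.lookup f w) (eval_letters a (letters w) v))"
proof -
  interpret vector_space scale by fact
  show ?thesis
    unfolding nc_eval_def using assms
    by (intro sum.mono_neutral_left) (auto simp: in_keys_iff)
qed

lemma nc_eval_single:
  assumes "vector_space scale"
  shows "nc_eval scale a (Poly_Mapping.single w c) v = scale c (eval_letters a (letters w) v)"
proof -
  interpret vector_space scale by fact
  show ?thesis
    by (subst nc_eval_superset[OF assms, of "{w}"]) auto
qed

lemma nc_eval_one: "vector_space scale \<Longrightarrow> nc_eval scale a 1 = id"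
  by (rule ext) (simp flip: single_one add: nc_eval_single zero_word_def vector_space_def)

lemma nc_eval_Var: "vector_space scale \<Longrightarrow> nc_eval scale a (Var i) = a i"
  by (rule ext) (simp add: Var_def nc_eval_single vector_space_def)

lemma nc_eval_add:
  assumes "vector_space scale"
  shows "nc_eval scale a (f + g) v = nc_eval scale a f v + nc_eval scale a g v"
proof -
  interpret vector_space scale by fact
  let ?K = "Poly_Mapping.keys f \<union> Poly_Mapping.keys g"
  have "Poly_Mapping.keys (f + g) \<subseteq> ?K" by (rule keys_add)
  then show ?thesis
    by (simp add: nc_eval_superset[OF assms, of ?K] lookup_add scale_left_distrib sum.distrib)
qed

lemma eval_letters_append:
  "eval_letters a (xs @ ys) = eval_letters a xs \<circ> eval_letters a ys"
  by (induction xs) auto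

lemma linear_eval_letters:
  assumes "vector_space scale" "\<And>i. a i \<in> End scale"
  shows "eval_letters a xs \<in> End scale"
proof (induction xs)
  case Nil
  interpret vector_space scale by fact
  show ?case by (simp add: End_def Vector_Spaces.linear_iff assms(1))
next
  case (Cons i xs)
  then show ?case
    using assms(2)[of i] by (auto simp: End_def Vector_Spaces.linear_iff)
qed

lemma poly_mapping_sum_induct [case_names zero single add]:
  fixes f :: "'b \<Rightarrow>\<^sub>0 'a::comm_monoid_add"
  assumes "P 0" "\<And>w c. P (Poly_Mapping.single w c)" "\<And>f g. P f \<Longrightarrow> P g \<Longrightarrow> P (f + g)"
  shows "P f"
proof -
  have "f = (\<Sum>w\<in>Poly_Mapping.keys f. Poly_Mapping.single w (Poly_Mapping.lookup f w))"
    by (rule poly_mapping_eqI)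
       (auto simp: lookup_sum lookup_single when_def in_keys_iff if_distrib sum.If_cases)
  moreover have "P (\<Sum>w\<in>K. Poly_Mapping.single w (Poly_Mapping.lookup f w))" for K
    by (induction K rule: infinite_finite_induct) (auto intro: assms)
  ultimately show ?thesis by metis
qed

lemma nc_eval_in_End:
  assumes "vector_space scale" "\<And>i. a i \<in> End scale"
  shows "nc_eval scale a f \<in> End scale"
proof -
  interpret vector_space scale by fact
  interpret vector_space_pair scale scale ..
  have "Vector_Spaces.linear scale scale (eval_letters a (letters w))" for w
    using linear_eval_letters[OF assms] by (simp add: End_def)
  then show ?thesis
    unfolding End_def nc_eval_def by (auto intro!: linear_compose_sum linear_compose_scale_right)
qed

lemma nc_eval_mult:
  assumes "vector_space scale" "\<And>i. a i \<in> End scale"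
  shows "nc_eval scale a (f * g) = nc_eval scale a f \<circ> nc_eval scale a g"
proof -
  interpret vector_space scale by fact
  have lin: "Vector_Spaces.linear scale scale (nc_eval scale a h)" for h
    using nc_eval_in_End[OF assms] by (simp add: End_def)
  have evalD: "nc_eval scale a h (u + v) = nc_eval scale a h u + nc_eval scale a h v" for h u v
    using lin[of h] by (simp add: Vector_Spaces.linear_iff)
  have eval0: "nc_eval scale a 0 v = 0" for v by (simp add: nc_eval_def)
  have lin': "eval_letters a xs (scale c v) = scale c (eval_letters a xs v)" for xs c v
    using linear_eval_letters[OF assms] by (simp add: End_def Vector_Spaces.linear_iff)
  have "nc_eval scale a (f * g) v = nc_eval scale a f (nc_eval scale a g v)" for v
  proof (induction f rule: poly_mapping_sum_induct)
    case (single w c)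
    show ?case
    proof (induction g rule: poly_mapping_sum_induct)
      case zero
      then show ?case
        using evalD[of _ 0 0] by (simp add: eval0)
    next
      case (single w' c')
      then show ?case
        by (simp add: mult_single nc_eval_single[OF assms(1)] plus_word_def eval_letters_append lin')
    next
      case (add g h)
      then show ?case
        by (simp add: distrib_left nc_eval_add[OF assms(1)] evalD)
    qed
  next
    case zero
    then show ?case by (simp add: eval0)
  next
    case (add f g)
    then show ?case by (simp add: distrib_right nc_eval_add[OF assms(1)])
  qed
  then show ?thesis by auto
qed

end

theory Submission
  imports Defs
begin

text \<open>
  Let \<open>w\<close> be a nonempty monomial of \<open>f\<close> of minimal length \<open>d\<close>, and let \<open>t\<^sub>j s\<^sub>k = \<delta>\<^sub>j\<^sub>k\<close>. Sending the
  \<open>i\<close>-th variable to the sum of the \<open>s\<^sub>k x\<^sub>k t\<^sub>k\<^sub>+\<^sub>1\<close> over the positions \<open>k\<close> of \<open>i\<close> in \<open>w\<close> kills every monomial of \<open>f\<close>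
  except \<open>w\<close> and the constant term, so that \<open>s\<^sub>0 X t\<^sub>d \<in> f(A) - f(A)\<close> for all \<open>X\<close>. As \<open>V\<close> is
  infinite-dimensional, this covers all off-diagonal entries of \<open>3 \<times> 3\<close> block matrices over
  \<open>A\<close>. The diagonal matrix with blocks \<open>xy\<close> and \<open>-yx\<close> is a sum of three conjugates of such elements, and
  every \<open>X\<close> in a corner is a commutator by an Eilenberg swindle, so each diagonal entry costs six elements.
  Altogether \<open>6 + 3 \<cdot> 6 = 24\<close> differences suffice.
\<close>

definition sum_of :: "nat \<Rightarrow> ('v \<Rightarrow> 'v::ab_group_add) set \<Rightarrow> ('v \<Rightarrow> 'v) \<Rightarrow> bool" where
  "sum_of n S T \<longleftrightarrow> (\<exists>D. (\<forall>i<n. D i \<in> S) \<and> T = (\<lambda>v. \<Sum>i<n. D i v))"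

lemma sum_of_1: "T \<in> S \<Longrightarrow> sum_of 1 S T"
  unfolding sum_of_def by (rule exI[of _ "\<lambda>_. T"]) auto

lemma sum_of_add:
  assumes "sum_of m S T" "sum_of n S U"
  shows "sum_of (m + n) S (\<lambda>v. T v + U v)"
proof -
  obtain D where D: "\<forall>i<m. D i \<in> S" "T = (\<lambda>v. \<Sum>i<m. D i v)"
    using assms(1) unfolding sum_of_def by (elim exE conjE)
  obtain E where E: "\<forall>i<n. E i \<in> S" "U = (\<lambda>v. \<Sum>i<n. E i v)"
    using assms(2) unfolding sum_of_def by (elim exE conjE)
  let ?D = "\<lambda>i. if i < m then D i else E (i - m)"
  have "(\<Sum>i<m + k. ?D i v) = T v + (\<Sum>i<k. E i v)" for v k
    by (induction k) (simp_all add: D(2) add.assoc)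
  then have "(\<lambda>v. T v + U v) = (\<lambda>v. \<Sum>i<m + n. ?D i v)"
    by (simp add: E(2))
  moreover have "\<forall>i<m + n. ?D i \<in> S"
    using D(1) E(1) by auto
  ultimately show ?thesis
    unfolding sum_of_def by (intro exI[of _ ?D] conjI)
qed

lemma sum_of_mono:
  assumes "sum_of m S T" "m \<le> n" "(\<lambda>v. 0) \<in> S"
  shows "sum_of n S T"
proof -
  have "sum_of k S (\<lambda>v. 0)" for k
    unfolding sum_of_def using assms(3) by (intro exI[of _ "\<lambda>_ _. 0"]) auto
  from sum_of_add[OF assms(1) this[of "n - m"]] show ?thesis
    using assms(2) by simp
qed

definition dual_system ::
  "('a::field \<Rightarrow> 'v::ab_group_add \<Rightarrow> 'v) \<Rightarrow> 'i set \<Rightarrow> ('i \<Rightarrow> 'v \<Rightarrow> 'v) \<Rightarrow> ('i \<Rightarrow> 'v \<Rightarrow> 'v) \<Rightarrow> bool"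
where
  "dual_system scale I p q \<longleftrightarrow> (\<forall>i\<in>I. p i \<in> End scale \<and> q i \<in> End scale) \<and>
     (\<forall>i\<in>I. \<forall>j\<in>I. \<forall>v. q i (p j v) = (if i = j then v else 0))"

context vector_space
begin

lemma End_iff:
  "T \<in> End scale \<longleftrightarrow> (\<forall>u v. T (u + v) = T u + T v) \<and> (\<forall>c v. T (c *s v) = c *s T v)"
  by (simp add: End_def Vector_Spaces.linear_iff vector_space_axioms)

lemma End_zero: "T \<in> End scale \<Longrightarrow> T 0 = 0"
  unfolding End_iff by (metis add_cancel_right_right)

lemma End_minus: "T \<in> End scale \<Longrightarrow> T (- v) = - T v"
  by (rule minus_unique[symmetric]) (metis End_iff End_zero add.right_inverse)

lemma End_diff: "T \<in> End scale \<Longrightarrow> T (u - v) = T u - T v"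
  using End_minus[of T v] unfolding End_iff by (metis diff_conv_add_uminus)

lemma End_sum: "T \<in> End scale \<Longrightarrow> T (sum h A) = (\<Sum>x\<in>A. T (h x))"
  by (induction A rule: infinite_finite_induct) (auto simp: End_zero End_iff)

lemma End_closed:
  "id \<in> End scale"
  "(\<lambda>v. v) \<in> End scale"
  "(\<lambda>v. 0) \<in> End scale"
  "g \<in> End scale \<Longrightarrow> h \<in> End scale \<Longrightarrow> (\<lambda>v. g (h v)) \<in> End scale"
  "g \<in> End scale \<Longrightarrow> h \<in> End scale \<Longrightarrow> (\<lambda>v. g v + h v) \<in> End scale"
  "g \<in> End scale \<Longrightarrow> h \<in> End scale \<Longrightarrow> (\<lambda>v. g v - h v) \<in> End scale"
  "g \<in> End scale \<Longrightarrow> (\<lambda>v. - g v) \<in> End scale"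
  "g \<in> End scale \<Longrightarrow> (\<lambda>v. c *s g v) \<in> End scale"
  "(\<And>x. x \<in> A \<Longrightarrow> G x \<in> End scale) \<Longrightarrow> (\<lambda>v. \<Sum>x\<in>A. G x v) \<in> End scale"
  by (auto simp: End_iff scale_right_distrib scale_right_diff_distrib sum.distrib scale_sum_right
      mult.commute intro!: sum.cong)

lemma funpow_End: "g \<in> End scale \<Longrightarrow> (\<lambda>v. (g ^^ n) v) \<in> End scale"
  by (induction n) (auto simp: End_iff)

lemma dual_systemD:
  assumes "dual_system scale I p q"
  shows "i \<in> I \<Longrightarrow> p i \<in> End scale" "i \<in> I \<Longrightarrow> q i \<in> End scale"
    "i \<in> I \<Longrightarrow> j \<in> I \<Longrightarrow> q i (p j v) = (if i = j then v else 0)"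
  using assms by (auto simp: dual_system_def)

lemma zero_in_differences: "(\<lambda>v. 0) \<in> differences (poly_image scale f)"
proof -
  have "nc_eval scale (\<lambda>_ _. 0) f \<in> poly_image scale f"
    unfolding poly_image_def using End_closed(3) by blast
  then show ?thesis
    unfolding differences_def by force
qed

text \<open>
  A word has a nonzero value at these staircase operators only along the path
  \<open>s\<^sub>0 \<leftarrow> s\<^sub>1 \<leftarrow> \<dots> \<leftarrow> s\<^sub>d\<close> labelled by \<open>is\<close>. Words shorter than the path are excluded
  by the minimality of \<open>is\<close>, longer ones do not fit.
\<close>

lemma staircase_in_differences:
  fixes f :: "'a free_algebra"
  assumes dual: "dual_system scale UNIV s t"
    and key: "Word is \<in> Poly_Mapping.keys f" and "is \<noteq> []"
    and minimal: "\<And>w. w \<in> Poly_Mapping.keys f \<Longrightarrow> w \<noteq> 0 \<Longrightarrow> length is \<le> length (letters w)"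
    and T: "T \<in> End scale"
  shows "(\<lambda>v. s 0 (T (t (length is) v))) \<in> differences (poly_image scale f)"
proof -
  note s [simp] = dual_systemD(1)[OF dual UNIV_I] and t [simp] = dual_systemD(2)[OF dual UNIV_I]
  note ts [simp] = dual_systemD(3)[OF dual UNIV_I UNIV_I]
  let ?d = "length is"
  define c where "c = Poly_Mapping.lookup f (Word is)"
  define x where "x X k = (if k = 0 then X else id)" for X :: "'b \<Rightarrow> 'b" and k :: nat
  define a where "a X i = (\<lambda>v. \<Sum>k\<in>{k. k < ?d \<and> is ! k = i}. s k (x X k (t (Suc k) v)))" for X i
  have "c \<noteq> 0" using key by (simp add: c_def in_keys_iff)
  have x_End: "x X k \<in> End scale" if "X \<in> End scale" for X k
    using that by (simp add: x_def End_closed)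
  have a_End: "a X i \<in> End scale" if "X \<in> End scale" for X i
    unfolding a_def by (intro End_closed(9) End_closed(4)[OF s End_closed(4)[OF x_End[OF that] t]])
  have t_a: "t m (a X i v) = (if m < ?d \<and> is ! m = i then x X m (t (Suc m) v) else 0)" for X m i v
    unfolding a_def by (simp add: End_sum)
  have t_eval: "t k (eval_letters (a X) js v) =
      (if k \<le> ?d \<and> drop k is = js @ drop (k + length js) is then t (k + length js) v else 0)"
    if "k > 0" "k \<le> ?d" for X js k v
    using that
  proof (induction js arbitrary: k)
    case (Cons j js)
    show ?case
    proof (cases "k < ?d")
      case True
      then have "drop k is = is ! k # drop (Suc k) is"
        by (simp add: Cons_nth_drop_Suc)
      with True Cons show ?thesis
        by (auto simp: t_a x_def)
    next
      case False
      then show ?thesis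
        using Cons.prems by (simp add: t_a)
    qed
  qed simp
  have eval: "eval_letters (a X) js v = (if js = is then s 0 (X (t ?d v)) else 0)"
    if X: "X \<in> End scale" and len: "?d \<le> length js" for X js v
  proof -
    obtain j ks where js: "js = j # ks"
      using len \<open>is \<noteq> []\<close> by (cases js) auto
    have "s k (x X k (t (Suc k) (eval_letters (a X) ks v))) =
        (if k = 0 \<and> drop 1 is = ks then s 0 (X (t ?d v)) else 0)" if k: "k < ?d" for k
    proof -
      have "(drop (Suc k) is = ks @ drop (Suc k + length ks) is) \<longleftrightarrow> k = 0 \<and> drop 1 is = ks"
      proof
        assume *: "drop (Suc k) is = ks @ drop (Suc k + length ks) is"
        then have "length ks \<le> length (drop (Suc k) is)"
          by (metis length_append le_add1)
        then have "k = 0" "length ks = ?d - 1"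
          using len js k by auto
        with * show "k = 0 \<and> drop 1 is = ks"
          using \<open>is \<noteq> []\<close> by simp
      qed auto
      moreover have "Suc k + length ks = ?d" if "k = 0" "drop 1 is = ks"
        using that \<open>is \<noteq> []\<close> by (cases "is") auto
      ultimately show ?thesis
        using k t_eval[of "Suc k" X ks v] X by (auto simp: x_def End_zero)
    qed
    then have "eval_letters (a X) js v = (\<Sum>k\<in>{k. k < ?d \<and> is ! k = j}.
        if k = 0 \<and> drop 1 is = ks then s 0 (X (t ?d v)) else 0)"
      by (simp add: js a_def)
    also have "\<dots> = (\<Sum>k\<in>{k. k < ?d \<and> is ! k = j}.
        if k = 0 then if drop 1 is = ks then s 0 (X (t ?d v)) else 0 else 0)"
      by (intro sum.cong) auto
    also have "\<dots> = (if is ! 0 = j \<and> drop 1 is = ks then s 0 (X (t ?d v)) else 0)"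
      using \<open>is \<noteq> []\<close> by (simp add: sum.delta)
    also have "is ! 0 = j \<and> drop 1 is = ks \<longleftrightarrow> js = is"
      using \<open>is \<noteq> []\<close> js by (cases "is") auto
    finally show ?thesis .
  qed
  have nc_eval_a: "nc_eval scale (a X) f v = Poly_Mapping.lookup f 0 *s v + c *s s 0 (X (t ?d v))"
    if X: "X \<in> End scale" for X v
  proof -
    let ?K = "insert 0 (Poly_Mapping.keys f)"
    have "nc_eval scale (a X) f v =
        (\<Sum>w\<in>?K. Poly_Mapping.lookup f w *s eval_letters (a X) (letters w) v)"
      by (rule nc_eval_superset) (auto simp: vector_space_axioms)
    also have "\<dots> = Poly_Mapping.lookup f 0 *s v +
        (\<Sum>w\<in>Poly_Mapping.keys f - {0}. Poly_Mapping.lookup f w *s eval_letters (a X) (letters w) v)"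
      by (subst sum.insert_remove) (auto simp: zero_word_def)
    also have "(\<Sum>w\<in>Poly_Mapping.keys f - {0}.
          Poly_Mapping.lookup f w *s eval_letters (a X) (letters w) v) =
        (\<Sum>w\<in>Poly_Mapping.keys f - {0}. if w = Word is then c *s s 0 (X (t ?d v)) else 0)"
    proof (rule sum.cong)
      fix w assume "w \<in> Poly_Mapping.keys f - {0}"
      then show "Poly_Mapping.lookup f w *s eval_letters (a X) (letters w) v =
          (if w = Word is then c *s s 0 (X (t ?d v)) else 0)"
        using eval[OF X, of "letters w" v] minimal[of w] by (cases w) (auto simp: c_def)
    qed simp
    also have "\<dots> = c *s s 0 (X (t ?d v))"
      using key \<open>is \<noteq> []\<close> by (simp add: zero_word_def)
    finally show ?thesis .
  qed
  let ?X = "\<lambda>v. inverse c *s T v"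
  have X: "?X \<in> End scale"
    using T by (rule End_closed(8))
  have "nc_eval scale (a ?X) f \<in> poly_image scale f"
    "nc_eval scale (a (\<lambda>v. 0)) f \<in> poly_image scale f"
    unfolding poly_image_def using a_End[OF X] a_End[OF End_closed(3)] by blast+
  moreover have "(\<lambda>v. s 0 (T (t ?d v))) =
      (\<lambda>v. nc_eval scale (a ?X) f v - nc_eval scale (a (\<lambda>v. 0)) f v)"
  proof -
    have "s 0 (u + v) = s 0 u + s 0 v" "s 0 (k *s v) = k *s s 0 v" for u v k
      using dual_systemD(1)[OF dual UNIV_I, of 0] unfolding End_iff by blast+
    then show ?thesis
      using \<open>c \<noteq> 0\<close> by (simp add: nc_eval_a X End_closed(3) End_zero)
  qed
  ultimately show ?thesis
    unfolding differences_def by blast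
qed

lemma infinite_basis_times_nat:
  assumes "\<nexists>B. finite_dimensional_vector_space scale B"
  obtains B :: "'b set" and e where "independent B" "span B = UNIV" "bij_betw e (B \<times> (UNIV :: nat set)) B"
proof -
  let ?B = "extend_basis {}"
  have B: "independent ?B" "span ?B = UNIV"
    by (simp_all add: independent_extend_basis independent_empty span_extend_basis)
  have "infinite ?B"
  proof
    assume "finite ?B"
    then have "finite_dimensional_vector_space scale ?B"
      by unfold_locales (use B in auto)
    with assms show False by blast
  qed
  then have "(card_of (?B \<times> (UNIV :: nat set)), card_of ?B) \<in> ordIso"
    by (intro card_of_Times_infinite[THEN conjunct1]) (auto simp: infinite_iff_card_of_nat)
  then show thesis
    using that B card_of_ordIso by blast
qed

end

text \<open>
  The operators \<open>s\<^sub>0, s\<^sub>1\<close> split \<open>V\<close> into two copies of itself. Iterating the splitting in the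
  second summand exhausts \<open>V\<close>, so that every \<open>a\<close> has an infinite repetition
  \<open>b = diag(a, a, \<dots>)\<close>.
\<close>

locale leavitt_pair = vector_space +
  fixes s0 s1 t0 t1 :: "'b \<Rightarrow> 'b"
  assumes End_s0: "s0 \<in> End scale" and End_s1: "s1 \<in> End scale"
    and End_t0: "t0 \<in> End scale" and End_t1: "t1 \<in> End scale"
    and t0_s0: "t0 (s0 v) = v" and t1_s1: "t1 (s1 v) = v"
    and t0_s1: "t0 (s1 v) = 0" and t1_s0: "t1 (s0 v) = 0"
    and complete: "s0 (t0 v) + s1 (t1 v) = v"
    and repetition: "a \<in> End scale \<Longrightarrow> \<exists>b \<in> End scale. \<forall>v. b v = s0 (a (t0 v)) + s1 (b (t1 v))"

lemma (in vector_space) leavitt_pair_exists: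
  assumes "\<nexists>B. finite_dimensional_vector_space scale B"
  obtains s0 s1 t0 t1 where "leavitt_pair scale s0 s1 t0 t1"
proof -
  obtain B :: "'b set" and e where B: "independent B" "span B = UNIV"
    and e: "bij_betw e (B \<times> (UNIV :: nat set)) B"
    using infinite_basis_times_nat[OF assms] .
  interpret vector_space_pair scale scale ..
  have eq: "g = h" if "g \<in> End scale" "h \<in> End scale"
    "\<And>b. b \<in> B \<Longrightarrow> g b = h b" for g h
  proof
    fix v
    show "g v = h v"
      by (rule linear_eq_on[of g h v B]) (use that B(2) in \<open>auto simp: End_def\<close>)
  qed
  define ex where "ex g = construct B (\<lambda>b. g (inv_into (B \<times> UNIV) e b))" for g :: "'b \<times> nat \<Rightarrow> 'b"
  have ex_End [simp]: "ex g \<in> End scale" for g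
    by (simp add: ex_def End_def linear_construct B)
  have e_in: "e (b, k) \<in> B" if "b \<in> B" for b k
    using bij_betwE[OF e] that by simp
  have ex: "ex g (e (b, k)) = g (b, k)" if "b \<in> B" for g b k
    using that e by (simp add: ex_def construct_basis B e_in bij_betw_inv_into_left)
  have ex_eq: "g = h" if "g \<in> End scale" "h \<in> End scale"
    "\<And>b k. b \<in> B \<Longrightarrow> g (e (b, k)) = h (e (b, k))" for g h
  proof (rule eq[OF that(1,2)])
    fix b assume "b \<in> B"
    then obtain x where "x \<in> B \<times> UNIV" "b = e x"
      using bij_betw_imp_surj_on[OF e] by blast
    then show "g b = h b"
      using that(3) by (cases x) simp
  qed
  define s0 where "s0 = construct B (\<lambda>b. e (b, 0))"
  define s1 where "s1 = ex (\<lambda>(b, k). e (b, Suc k))"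
  define t0 where "t0 = ex (\<lambda>(b, k). if k = 0 then b else 0)"
  define t1 where "t1 = ex (\<lambda>(b, k). case k of 0 \<Rightarrow> 0 | Suc k \<Rightarrow> e (b, k))"
  have s0_End: "s0 \<in> End scale"
    by (simp add: s0_def End_def linear_construct B)
  have s0: "s0 b = e (b, 0)" if "b \<in> B" for b
    using that by (simp add: s0_def construct_basis B)
  have End [simp]: "s0 \<in> End scale" "s1 \<in> End scale" "t0 \<in> End scale" "t1 \<in> End scale"
    by (auto simp: s0_End s1_def t0_def t1_def)
  note on_basis = s0 s1_def t0_def t1_def ex e_in End_zero[OF End(1)] End_zero[OF ex_End]
  have "leavitt_pair scale s0 s1 t0 t1"
  proof
    have "(\<lambda>v. t0 (s0 v)) = (\<lambda>v. v)"
      by (rule eq[OF End_closed(4)[OF End(3,1)] End_closed(2)]) (simp add: on_basis)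
    then show "t0 (s0 v) = v" for v
      by meson
    have "(\<lambda>v. t1 (s0 v)) = (\<lambda>v. 0)"
      by (rule eq[OF End_closed(4)[OF End(4,1)] End_closed(3)]) (simp add: on_basis)
    then show "t1 (s0 v) = 0" for v
      by meson
    have "(\<lambda>v. t1 (s1 v)) = (\<lambda>v. v)"
      by (rule ex_eq[OF End_closed(4)[OF End(4,2)] End_closed(2)]) (simp add: on_basis)
    then show "t1 (s1 v) = v" for v
      by meson
    have "(\<lambda>v. t0 (s1 v)) = (\<lambda>v. 0)"
      by (rule ex_eq[OF End_closed(4)[OF End(3,2)] End_closed(3)]) (simp add: on_basis)
    then show "t0 (s1 v) = 0" for v
      by meson
    have "(\<lambda>v. s0 (t0 v) + s1 (t1 v)) = (\<lambda>v. v)"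
      by (rule ex_eq[OF End_closed(5)[OF End_closed(4)[OF End(1,3)] End_closed(4)[OF End(2,4)]] End_closed(2)])
        (simp add: on_basis split: nat.split)
    then show "s0 (t0 v) + s1 (t1 v) = v" for v
      by meson
    fix a assume a: "a \<in> End scale"
    define b where "b = ex (\<lambda>(x, k). (s1 ^^ k) (s0 (a x)))"
    have "b \<in> End scale"
      by (simp add: b_def)
    moreover have "b = (\<lambda>v. s0 (a (t0 v)) + s1 (b (t1 v)))"
    proof (rule ex_eq[OF \<open>b \<in> End scale\<close> End_closed(5)[OF
          End_closed(4)[OF End(1) End_closed(4)[OF a End(3)]]
          End_closed(4)[OF End(2) End_closed(4)[OF \<open>b \<in> End scale\<close> End(4)]]]])
      fix x k assume x: "x \<in> B"
      show "b (e (x, k)) = s0 (a (t0 (e (x, k)))) + s1 (b (t1 (e (x, k))))"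
        using x a by (cases k) (auto simp: b_def t0_def t1_def ex End_zero)
    qed
    ultimately show "\<exists>b \<in> End scale. \<forall>v. b v = s0 (a (t0 v)) + s1 (b (t1 v))"
      by (intro bexI[of _ b] allI) (erule fun_cong)
  qed auto
  then show thesis
    by (rule that)
qed

context leavitt_pair
begin

lemmas End_pair = End_s0 End_s1 End_t0 End_t1

lemma dual_sequence:
  "dual_system scale UNIV (\<lambda>k v. (s1 ^^ k) (s0 v)) (\<lambda>k v. t0 ((t1 ^^ k) v))"
proof -
  have cancel: "(t1 ^^ k) ((s1 ^^ (k + m)) v) = (s1 ^^ m) v" for k m v
    by (induction k) (simp_all add: funpow_swap1[of t1] t1_s1)
  have cancel': "(t1 ^^ (k + m)) ((s1 ^^ k) v) = (t1 ^^ m) v" for k m v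
    by (induction k arbitrary: v) (simp_all add: funpow_swap1[of t1] t1_s1)
  have "t0 ((t1 ^^ i) ((s1 ^^ j) (s0 v))) = (if i = j then v else 0)" for i j v
  proof (cases i j rule: linorder_cases)
    case less
    then obtain m where "j = i + Suc m"
      by (metis less_imp_Suc_add add_Suc_right)
    then show ?thesis
      using cancel[of i "Suc m" "s0 v"] by (simp add: t0_s1)
  next
    case equal
    then show ?thesis
      using cancel[of i 0 "s0 v"] by (simp add: t0_s0)
  next
    case greater
    then obtain m where "i = j + Suc m"
      by (metis less_imp_Suc_add add_Suc_right)
    moreover have "(t1 ^^ m) 0 = 0"
      using End_zero[OF funpow_End[OF End_t1]] .
    ultimately show ?thesis
      using cancel'[of j "Suc m" "s0 v"] by (simp add: t1_s0 funpow_swap1[of t1] End_zero End_t0)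
  qed
  moreover have "(\<lambda>v. (s1 ^^ k) (s0 v)) \<in> End scale" "(\<lambda>v. t0 ((t1 ^^ k) v)) \<in> End scale" for k
    using End_pair funpow_End by (simp_all add: End_iff)
  ultimately show ?thesis
    unfolding dual_system_def by simp
qed

lemma offdiagonal_in_differences:
  fixes f :: "'a free_algebra"
  assumes f: "\<not> constant_poly f"
    and dual: "dual_system scale I p q"
    and ind: "i \<in> I" "j \<in> I" "l \<in> I" "i \<noteq> j" "i \<noteq> l" "j \<noteq> l"
    and X: "X \<in> End scale"
  shows "(\<lambda>v. p i (X (q j v))) \<in> differences (poly_image scale f)"
proof -
  define N where "N = Poly_Mapping.keys f - {0}"
  have "N \<noteq> {}"
  proof
    assume "N = {}"
    then have "f = Poly_Mapping.single 0 (Poly_Mapping.lookup f 0)"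
      unfolding N_def by (intro poly_mapping_eqI) (auto simp: lookup_single in_keys_iff when_def)
    with f show False
      unfolding constant_poly_def by blast
  qed
  then obtain w where w: "w \<in> N" and min: "\<And>u. u \<in> N \<Longrightarrow> length (letters w) \<le> length (letters u)"
    using ex_has_least_nat[of "\<lambda>w. w \<in> N" _ "\<lambda>w. length (letters w)"] by blast
  let ?d = "length (letters w)"
  have ne: "letters w \<noteq> []"
    using w by (cases w) (auto simp: N_def zero_word_def)
  let ?s = "\<lambda>k v. (s1 ^^ k) (s0 v)" and ?t = "\<lambda>k v. t0 ((t1 ^^ k) v)"
  define S where "S k = (if k = 0 then p i else if k = ?d then p j else (\<lambda>v. p l (?s k v)))" for k
  define T where "T k = (if k = 0 then q i else if k = ?d then q j else (\<lambda>v. ?t k (q l v)))" for k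
  note e = dual_systemD[OF dual_sequence UNIV_I]
  have "S k \<in> End scale" "T k \<in> End scale" for k
    using ind dual_systemD(1,2)[OF dual] End_closed(4)[OF _ e(1)[of k]] End_closed(4)[OF e(2)[of k]]
    by (auto simp: S_def T_def)
  moreover have "T k (S m v) = (if k = m then v else 0)" for k m v
    using ne ind e(3)[OF UNIV_I] dual_systemD[OF dual] End_zero[OF e(2)]
    by (auto simp: S_def T_def End_zero)
  ultimately have "dual_system scale UNIV S T"
    by (simp add: dual_system_def)
  from staircase_in_differences[OF this _ ne _ X, of f] show ?thesis
    using w ne min by (simp add: S_def T_def N_def)
qed

text \<open>
  The operators \<open>p\<^sub>i x y q\<^sub>i - p\<^sub>i x y x q\<^sub>j + p\<^sub>j y q\<^sub>i - p\<^sub>j y x q\<^sub>j\<close> factor as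
  \<open>(p\<^sub>j + p\<^sub>i x) y (q\<^sub>i - x q\<^sub>j)\<close>, which is off-diagonal in the dual system with \<open>p\<^sub>j\<close> and
  \<open>q\<^sub>i\<close> changed accordingly.
\<close>

lemma diagonal_difference:
  fixes f :: "'a free_algebra"
  assumes f: "\<not> constant_poly f"
    and dual: "dual_system scale I p q"
    and ind: "i \<in> I" "j \<in> I" "l \<in> I" "i \<noteq> j" "i \<noteq> l" "j \<noteq> l"
    and x: "x \<in> End scale" and y: "y \<in> End scale"
  shows "sum_of 3 (differences (poly_image scale f)) (\<lambda>v. p i (x (y (q i v))) - p j (y (x (q j v))))"
proof -
  note d = dual_systemD[OF dual]
  let ?p = "p(j := \<lambda>v. p j v + p i (x v))" and ?q = "q(i := \<lambda>v. q i v - x (q j v))"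
  have "dual_system scale I ?p ?q"
    unfolding dual_system_def
  proof (intro conjI ballI allI)
    fix k assume "k \<in> I"
    then show "?p k \<in> End scale" "?q k \<in> End scale"
      using d(1,2) End_closed(5)[OF d(1)[OF ind(2)] End_closed(4)[OF d(1)[OF ind(1)] x]]
        End_closed(6)[OF d(2)[OF ind(1)] End_closed(4)[OF x d(2)[OF ind(2)]]]
      by simp_all
    have lin: "q m (u + v) = q m u + q m v" if "m \<in> I" for m u v
      using d(2)[OF that] by (simp add: End_iff)
    fix m v assume "m \<in> I"
    then show "?q k (?p m v) = (if k = m then v else 0)"
      using \<open>k \<in> I\<close> ind x by (simp add: d lin End_zero)
  qed
  from offdiagonal_in_differences[OF f this ind(2,1,3) _ ind(6,5) y] ind(4)
  have 1: "(\<lambda>v. p j (y (q i v - x (q j v))) + p i (x (y (q i v - x (q j v)))))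
      \<in> differences (poly_image scale f)" by simp
  have 2: "(\<lambda>v. p i (x (y (x (q j v))))) \<in> differences (poly_image scale f)"
    using offdiagonal_in_differences[OF f dual ind End_closed(4)[OF x End_closed(4)[OF y x]]] .
  have 3: "(\<lambda>v. p j (- y (q i v))) \<in> differences (poly_image scale f)"
    using offdiagonal_in_differences[OF f dual ind(2,1,3) _ ind(6,5) End_closed(7)[OF y]] ind(4)
    by simp
  have "(\<lambda>v. p i (x (y (q i v))) - p j (y (x (q j v)))) =
     (\<lambda>v. (p j (y (q i v - x (q j v))) + p i (x (y (q i v - x (q j v)))) + p i (x (y (x (q j v)))))
        + p j (- y (q i v)))"
    using x y d(1)[OF ind(1)] d(1)[OF ind(2)] by (simp add: End_diff End_minus)
  with sum_of_add[OF sum_of_add[OF sum_of_1[OF 1] sum_of_1[OF 2]] sum_of_1[OF 3]]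
  show ?thesis by (simp add: numeral_3_eq_3)
qed

text \<open>
  With \<open>b = diag(X, X, \<dots>)\<close> the operator \<open>s\<^sub>0 X t\<^sub>0\<close> is the commutator of \<open>b t\<^sub>1\<close> and \<open>s\<^sub>1\<close>.
  The new dual system makes room for \<open>b\<close> in the ranges of \<open>p\<^sub>i\<close> and \<open>p\<^sub>j\<close>.
\<close>

lemma diagonal_sum_of_differences:
  fixes f :: "'a free_algebra"
  assumes f: "\<not> constant_poly f"
    and dual: "dual_system scale I p q"
    and ind: "i \<in> I" "j \<in> I" "l \<in> I" "i \<noteq> j" "i \<noteq> l" "j \<noteq> l"
    and X: "X \<in> End scale"
  shows "sum_of 6 (differences (poly_image scale f)) (\<lambda>v. p i (X (q i v)))"
proof -
  note d = dual_systemD[OF dual]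
  note [simp] = t0_s0 t0_s1 t1_s0 t1_s1
  obtain b where b: "b \<in> End scale" "\<forall>v. b v = s0 (X (t0 v)) + s1 (b (t1 v))"
    using repetition[OF X] by (rule bexE)
  define P :: "nat \<Rightarrow> 'b \<Rightarrow> 'b" where
    "P k = (if k = 0 then (\<lambda>v. p i (t0 v) + p j (t1 v))
      else if k = 1 then (\<lambda>v. p l (s0 v)) else (\<lambda>v. p l (s1 v)))" for k
  define Q :: "nat \<Rightarrow> 'b \<Rightarrow> 'b" where
    "Q k = (if k = 0 then (\<lambda>v. s0 (q i v) + s1 (q j v))
      else if k = 1 then (\<lambda>v. t0 (q l v)) else (\<lambda>v. t1 (q l v)))" for k
  have lin: "q m (u + v) = q m u + q m v" if "m \<in> I" for m u v
    using d(2)[OF that] by (simp add: End_iff)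
  have "P k \<in> End scale" "Q k \<in> End scale" for k
    using End_closed(5)[OF End_closed(4)[OF d(1)[OF ind(1)] End_t0] End_closed(4)[OF d(1)[OF ind(2)] End_t1]]
      End_closed(5)[OF End_closed(4)[OF End_s0 d(2)[OF ind(1)]] End_closed(4)[OF End_s1 d(2)[OF ind(2)]]]
      End_closed(4)[OF d(1)[OF ind(3)] End_s0] End_closed(4)[OF d(1)[OF ind(3)] End_s1]
      End_closed(4)[OF End_t0 d(2)[OF ind(3)]] End_closed(4)[OF End_t1 d(2)[OF ind(3)]]
    by (simp_all add: P_def Q_def)
  moreover have "Q k (P m v) = (if k = m then v else 0)" if "k \<in> {0, 1, 2}" "m \<in> {0, 1, 2}" for k m v
    using that ind
    by (auto simp: P_def Q_def lin d(3) complete End_zero[OF d(2)] End_zero End_pair)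
  ultimately have PQ: "dual_system scale {0, 1, 2} P Q"
    by (simp add: dual_system_def)
  have P0: "P 0 \<in> End scale"
    using dual_systemD(1)[OF PQ, of 0] by simp
  let ?x = "\<lambda>v. b (t1 v)" and ?z = "\<lambda>v. - s1 (b (t1 v))"
  have End_xz: "?x \<in> End scale" "?z \<in> End scale"
    using b(1) End_pair by (simp_all add: End_iff)
  note D = diagonal_difference[OF f PQ, of 0 1 2]
  have 1: "sum_of 3 (differences (poly_image scale f))
      (\<lambda>v. P 0 (b (t1 (s1 (Q 0 v)))) - P 1 (s1 (b (t1 (Q 1 v)))))"
    using D[OF _ _ _ _ _ _ End_xz(1) End_s1] by simp
  have 2: "sum_of 3 (differences (poly_image scale f))
      (\<lambda>v. P 0 (- s1 (b (t1 (Q 0 v)))) - P 1 (- s1 (b (t1 (Q 1 v)))))"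
    using D[OF _ _ _ _ _ _ End_xz(2) End_closed(2)] by simp
  have "(\<lambda>v. p i (X (q i v))) =
     (\<lambda>v. P 0 (b (t1 (s1 (Q 0 v)))) - P 1 (s1 (b (t1 (Q 1 v)))) +
        (P 0 (- s1 (b (t1 (Q 0 v)))) - P 1 (- s1 (b (t1 (Q 1 v))))))"
  proof
    fix v
    have t0_Q: "t0 (Q 0 v) = q i v"
      using End_t0 by (simp add: Q_def End_iff)
    have P0_s0: "P 0 (s0 u) = p i u" for u
      using d(1)[OF ind(2)] by (simp add: P_def End_zero)
    have "b (Q 0 v) - s1 (b (t1 (Q 0 v))) = s0 (X (q i v))"
      using b(2)[rule_format, of "Q 0 v"] by (simp add: t0_Q)
    then have "p i (X (q i v)) = P 0 (b (Q 0 v) - s1 (b (t1 (Q 0 v))))"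
      by (simp add: P0_s0)
    moreover have "P 1 (- u) = - P 1 u" for u
      using dual_systemD(1)[OF PQ, of 1] by (simp add: End_minus)
    ultimately show "p i (X (q i v)) = P 0 (b (t1 (s1 (Q 0 v)))) - P 1 (s1 (b (t1 (Q 1 v)))) +
        (P 0 (- s1 (b (t1 (Q 0 v)))) - P 1 (- s1 (b (t1 (Q 1 v)))))"
      using P0 by (simp add: End_minus End_diff)
  qed
  with sum_of_add[OF 1 2] show ?thesis by simp
qed

lemma sum_of_24_differences:
  fixes f :: "'a free_algebra"
  assumes f: "\<not> constant_poly f" and T: "T \<in> End scale"
  shows "sum_of 24 (differences (poly_image scale f)) T"
proof -
  note [simp] = t0_s0 t0_s1 t1_s0 t1_s1
  define p :: "nat \<Rightarrow> 'b \<Rightarrow> 'b" where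
    "p k = (if k = 0 then s0 else if k = 1 then (\<lambda>v. s1 (s0 v)) else (\<lambda>v. s1 (s1 v)))" for k
  define q :: "nat \<Rightarrow> 'b \<Rightarrow> 'b" where
    "q k = (if k = 0 then t0 else if k = 1 then (\<lambda>v. t0 (t1 v)) else (\<lambda>v. t1 (t1 v)))" for k
  have "p k \<in> End scale" "q k \<in> End scale" for k
    using End_pair by (simp_all add: p_def q_def End_iff)
  then have pq: "dual_system scale {0, 1, 2} p q"
    by (auto simp: dual_system_def p_def q_def End_zero End_pair)
  note d = dual_systemD[OF pq]
  have one: "p 0 (q 0 v) + p 1 (q 1 v) + p 2 (q 2 v) = v" for v
  proof -
    have "s1 (s0 (t0 (t1 v))) + s1 (s1 (t1 (t1 v))) = s1 (s0 (t0 (t1 v)) + s1 (t1 (t1 v)))"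
      using End_s1 by (simp add: End_iff)
    then show ?thesis
      by (simp add: p_def q_def add.assoc complete)
  qed
  let ?X = "\<lambda>i j v. q i (T (p j v))"
  have X: "?X i j \<in> End scale" if "i \<in> {0, 1, 2}" "j \<in> {0, 1, 2}" for i j
    using d(1)[OF that(2)] d(2)[OF that(1)] T by (simp add: End_iff)
  let ?sum = "\<lambda>n. sum_of n (differences (poly_image scale f))"
  have off: "?sum 1 (\<lambda>v. p i (?X i j (q j v)))"
    if "i \<in> {0, 1, 2}" "j \<in> {0, 1, 2}" "l \<in> {0, 1, 2}" "i \<noteq> j" "i \<noteq> l" "j \<noteq> l" for i j l
    using offdiagonal_in_differences[OF f pq that X[OF that(1,2)]] by (rule sum_of_1)
  have diag: "?sum 6 (\<lambda>v. p i (?X i i (q i v)))"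
    if "i \<in> {0, 1, 2}" "j \<in> {0, 1, 2}" "l \<in> {0, 1, 2}" "i \<noteq> j" "i \<noteq> l" "j \<noteq> l" for i j l
    using diagonal_sum_of_differences[OF f pq that X[OF that(1,1)]] .
  have row: "?sum 8 (\<lambda>v. p i (q i (T v)))"
    if "i \<in> {0, 1, 2}" "j \<in> {0, 1, 2}" "l \<in> {0, 1, 2}" "i \<noteq> j" "i \<noteq> l" "j \<noteq> l"
      "\<And>v. p i (q i v) + p j (q j v) + p l (q l v) = v" for i j l
  proof -
    have sum: "?sum (6 + 1 + 1) (\<lambda>v. p i (?X i i (q i v)) + p i (?X i j (q j v)) + p i (?X i l (q l v)))"
      by (intro sum_of_add diag[OF that(1-6)] off[OF that(1-6)]
          off[OF that(1,3,2,5,4) that(6)[symmetric]])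
    have eq: "(\<lambda>v. p i (q i (T v))) =
        (\<lambda>v. p i (?X i i (q i v)) + p i (?X i j (q j v)) + p i (?X i l (q l v)))"
    proof
      fix v
      have "p i (q i (T (u + u' + u''))) =
          p i (q i (T u)) + p i (q i (T u')) + p i (q i (T u''))" for u u' u''
        using d(1)[OF that(1)] d(2)[OF that(1)] T by (simp add: End_iff)
      from this[of "p i (q i v)" "p j (q j v)" "p l (q l v)"]
      show "p i (q i (T v)) =
          p i (?X i i (q i v)) + p i (?X i j (q j v)) + p i (?X i l (q l v))"
        by (simp add: that(7))
    qed
    show ?thesis
      by (subst eq) (use sum in simp)
  qed
  have one': "p 1 (q 1 v) + p 0 (q 0 v) + p 2 (q 2 v) = v"
    "p 2 (q 2 v) + p 0 (q 0 v) + p 1 (q 1 v) = v" for v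
    using one[of v] by (simp_all only: ac_simps)
  have "?sum (8 + 8 + 8) (\<lambda>v. p 0 (q 0 (T v)) + p 1 (q 1 (T v)) + p 2 (q 2 (T v)))"
    by (intro sum_of_add row[of 0 1 2] row[of 1 0 2] row[of 2 0 1] one one') simp_all
  then show ?thesis
    unfolding one by simp
qed

end

theorem corollary3p15:
  fixes scale :: "'a::field \<Rightarrow> 'v::ab_group_add \<Rightarrow> 'v"
    and f :: "'a free_algebra"
    and T :: "'v \<Rightarrow> 'v"
  assumes "infinite (UNIV :: 'a set)"
    and "CHAR('a) \<noteq> 2"
    and "vector_space scale"
    and "\<nexists>B. finite_dimensional_vector_space scale B"
    and "\<not> constant_poly f"
    and "T \<in> End scale"
  shows "\<exists>D. (\<forall>i<1958. D i \<in> differences (poly_image scale f)) \<and>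
             T = (\<lambda>v. \<Sum>i<(1958::nat). D i v)"
proof -
  interpret vector_space scale by fact
  obtain s0 s1 t0 t1 where "leavitt_pair scale s0 s1 t0 t1"
    using leavitt_pair_exists[OF assms(4)] .
  then interpret leavitt_pair scale s0 s1 t0 t1 .
  have "sum_of 24 (differences (poly_image scale f)) T"
    using assms(5,6) by (rule sum_of_24_differences)
  then have "sum_of 1958 (differences (poly_image scale f)) T"
    by (rule sum_of_mono) (simp_all add: zero_in_differences)
  then show ?thesis
    unfolding sum_of_def .
qed

end
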